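(* Let $\varphi$ be a well-defined RTLola specification, let $a \in \mathtt{ID} \rightarrow \mathcal{P}(\text{Cond} \times \mathbb{V})$ be an annotation, and let $B = B_b$ be the simple bandwidth bound with threshold $b$. \begin{itemize} \item The priority scheduler $PS_{\xi_a,B}$ and the deadline-priority scheduler $DPS_{\xi_a,B}$ are valid if $b \ge \max_{\tau \in \text{Tasks}} |\tau|$. \item The deadline scheduler $DS_{\xi_a,B}$ is valid if $\forall \tau \in \text{Tasks}.\ \forall (c,dl) \in \xi_a(\tau).\ dl > n$ and $b \ge \max_{\tau \in \text{Tasks}} |\tau|$, where \begin{align*} n &= \min \{ n' \mid \forall \mathcal{T} \in \mathit{Permutations}_{|\text{Tasks}|}(\text{Tasks}).\ \mathit{splits}_B(\mathcal{T}, \varepsilon) = n' \},\\ \mathit{Permutations}_{|\text{Tasks}|}(\text{Tasks}) &= \{ \tau_1\tau_2\ldots \in \text{Tasks}^{|\text{Tasks}|} \mid \forall i,j.\ i = j \lor \tau_i \ne \tau_j \},\\ \mathit{splits}_B(\varepsilon, cur) &= 1,\\ \mathit{splits}_B(\tau_1 \circ \mathcal{T}, cur) &= \begin{cases} 1 + \mathit{splits}_B(\tau_1 \circ \mathcal{T}, \varepsilon) & \text{if } |cur \cup \tau_1| > b\\ \mathit{splits}_B(\mathcal{T}, cur \cup \tau_1) & \text{otherwise.}\end{cases} \end{align*} \end{itemize}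
   Context: Semantics: an evaluation model $\omega \in \mathbb{W}$ assigns each stream identifier in $\mathtt{ID} = \mathtt{ID}^\uparrow \cup \mathtt{ID}^\downarrow$ (input and output streams) and each discrete time step $t \in \mathbb{N}$ a value or $\bot$ (no new value), written $\omega(sid)(t)$, and each step a real timestamp $\omega(t)$. $[\![\varphi]\!]$ is the set of evaluation models in which every output stream value equals the value of its defining stream equation at every step and timestamps are strictly increasing. $\varphi$ is well-defined if for every input trace there is a unique $\omega \in [\![\varphi]\!]$ agreeing with it on the input streams. Tasks: $\text{Tasks} = \mathcal{P}(\mathtt{ID}^\uparrow)$ (sets of input streams); $\omega \models_t \tau$ (τ satisfied at $t$) iff $\forall i \in \tau.\ \omega(i)(t) \ne \bot$; dependency order $\tau_1 \preceq \tau_2$ iff $\tau_1 \subseteq \tau_2$; an input valuation $iv$ reflects a task set $\mathcal{T}$ iff $\forall s \in \mathtt{ID}^\uparrow.\ iv(s) \ne \bot \Leftrightarrow \{s\} \in \mathcal{T}$. Bandwidth: $B_b(\omega,t)$ holds iff $|\{i \in \mathtt{ID}^\uparrow \mid \omega(i)(t) \ne \bot\}| \le b$. Annotation and static schedule: $\text{Cond}$ are conditions evaluable to a boolean at $(\omega,t)$; $\mathbb{V}$ is either deadlines ($\mathbb{R}$) or priorities ($\mathbb{N}$). Each stream is annotated with (condition, value) pairs, the condition combining the stream's pacing and the (mutually exclusive) when-condition of its eval clause. The static schedule is $\xi_a(\tau) = \{(c,v) \mid v = \max\{v' \mid \exists s \in \mathtt{ID}.\ \mathit{pac}(s) \subseteq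 \tau \land (c',v') \in a(s) \land c' \Rightarrow c\}\}$, where $\mathit{pac}(s)$ is the set of inputs in the pacing of $s$ and $\max$ means most restrictive (highest priority / shortest deadline). Dynamic constraints: a dynamic schedule constraint $\psi : (\mathbb{W} \times \mathbb{N}) \to \text{Tasks} \to \{\text{Y},\text{M},\text{N}\}$ (must/may/must not be evaluated); $[\![\psi]\!]$ contains $\omega$ iff for all $t,\tau$: $\psi(\omega,t)(\tau)=\text{Y} \Rightarrow \omega \models_{t+1} \tau$ and $\psi(\omega,t)(\tau)=\text{N} \Rightarrow \omega \not\models_{t+1} \tau$. From a static schedule $\xi$ one derives $\psi_\xi$: (Deadline) $\psi(\omega,t)(\tau)=\text{Y}$ if some $(c,dl)\in\xi(\tau)$ and $t'<t$ have $c$ true at $t'$, $\tau$ unsatisfied at all steps in $(t',t]$, and $\omega(t+2) > \omega(t')+dl$; otherwise M. (Priority) $\mathit{Prio}_\xi(\tau,\omega,t)$ is the pair $(c,p)\in\xi(\tau)$ whose condition was most recently true at some $t'\le t$ (or $\bot$). $\psi(\omega,t)(\tau)=\text{Y}$ if $\mathit{Prio}_\xi(\tau,\omega,t)=(c_1,p_1)$, some $\tau'$ with $\mathit{Prio}_\xi(\tau',\omega,t)=(c_2,p_2)$ satisfies $\omega\models_{t+1}\tau'$ and $p_1>p_2$, and no $\tau''\succeq\tau$ has $\omega\models_{t+1}\tau''$; otherwise M. (Deadline-priority) each task has a global deadline $dl_\tau$; $\mathit{overdue}(\tau,\omega,t)$ iff some $\tau'\subseteq\tau$ has $\omega(t)$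 minus the timestamp of the last step $t'<t$ with $\omega\models_{t'}\tau'$ exceeding $dl_\tau$. $\psi(\omega,t)(\tau)=\text{Y}$ if $\tau$ is overdue at $t+1$ and some non-overdue $\tau'$ is satisfied at $t+1$, or if the priority condition holds with $\tau'$ additionally not overdue at $t+1$; otherwise M. Scheduled semantics: $[\![(\varphi,\xi,B)]\!] = \{\omega \mid \omega\in[\![\varphi]\!] \land \omega\in[\![\psi_\xi]\!] \land \forall t.\ B(\omega,t)\}$. Valid scheduler: a scheduler $SA : \mathbb{W}\times\mathbb{N} \to \mathcal{P}(\text{Tasks})$ (tasks evaluated at the next step) is valid if (1) for all $\omega\in[\![(\varphi,\xi,B)]\!]$, $t$, $\mathcal{T}$, input valuations $i$: if $\mathit{validTasks}(\omega,t'+1,SA(\omega,t'))$ holds for all $t'<t$, $SA(\omega,t)=\mathcal{T}$ and $i$ reflects $\mathcal{T}$, then there is $\omega'\in[\![(\varphi,\xi,B)]\!]$ with $\mathit{validTasks}(\omega',t+1,\mathcal{T})$, $\omega'$ equal to $\omega$ up to $t$, and inputs $i$ at $t+1$; and (2) for all such $\omega$ and $t$ there is $t'>t$ with $|SA(\omega,t')|\ge 1$. Here $\mathit{validTasks}(\omega,t,\mathcal{T})$ holds iff exactly the tasks in $\mathcal{T}$ are satisfied at $t$, $\mathcal{T}$ is upward closed under strict $\preceq$, and $\mathcal{T}$ is closed under union. Schedulers: each cycle fills an event with at most $b$ inputs by taking tasks greedily in a total order while the union fits, returning all tasks contained in the union. $DS_{\xi,B}$ orders by earliest deadline (last evaluation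 + deadline value), $PS_{\xi,B}$ by decreasing priority, $DPS_{\xi,B}$ like $PS$ but overdue tasks first; ties broken by least recently evaluated.
   Formalization: Well-definedness is taken also for finite input traces: outputs up to a step may not depend on later inputs or timestamps (otherwise the claim fails); conditions at (ω,t) are evaluated on steps 0..t only. *)

theory Defs
  imports "HOL-Library.Extended_Real"
begin

text \<open>
  The input streams are the elements of a finite type \<open>'i\<close>, the output streams those of \<open>'o\<close>,
  and a stream identifier is an element of \<open>'i + 'o\<close>. One step of an evaluation model carries its
  timestamp and a new value, or \<open>None\<close> for \<open>\<bottom>\<close>, for every stream.
\<close>

type_synonym ('i, 'o, 'v) event = "real \<times> ('i + 'o \<Rightarrow> 'v option)"
type_synonym ('i, 'o, 'v) evmodel = "nat \<Rightarrow> ('i, 'o, 'v) event"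
type_synonym ('i, 'v) input_trace = "nat \<Rightarrow> real \<times> ('i \<Rightarrow> 'v option)"

definition ts :: "('i, 'o, 'v) evmodel \<Rightarrow> nat \<Rightarrow> real" where
  "ts \<omega> t = fst (\<omega> t)"

definition val :: "('i, 'o, 'v) evmodel \<Rightarrow> 'i + 'o \<Rightarrow> nat \<Rightarrow> 'v option" where
  "val \<omega> s t = snd (\<omega> t) s"

definition inputs_at :: "('i, 'o, 'v) evmodel \<Rightarrow> nat \<Rightarrow> 'i \<Rightarrow> 'v option" where
  "inputs_at \<omega> t i = val \<omega> (Inl i) t"

text \<open>
  \<open>equation \<phi> x \<omega> t\<close> is the value at step \<open>t\<close> of the whole declaration of the output \<open>x\<close> (pacing,
  when-conditions and expressions), hence \<open>None\<close> where \<open>x\<close> is not evaluated.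
  \<open>out_pacing\<close> is the set of inputs occurring in the pacing annotation.
\<close>

record ('i, 'o, 'v) spec =
  out_pacing :: "'o \<Rightarrow> 'i set"
  equation :: "'o \<Rightarrow> ('i, 'o, 'v) evmodel \<Rightarrow> nat \<Rightarrow> 'v option"

fun pac :: "('i, 'o, 'v) spec \<Rightarrow> 'i + 'o \<Rightarrow> 'i set" where
  "pac \<phi> (Inl i) = {i}"
| "pac \<phi> (Inr x) = out_pacing \<phi> x"

definition models :: "('i, 'o, 'v) spec \<Rightarrow> ('i, 'o, 'v) evmodel set" where
  "models \<phi> = {\<omega>. (\<forall>x t. val \<omega> (Inr x) t = equation \<phi> x \<omega> t) \<and> strict_mono (ts \<omega>)}"

definition agrees_with :: "enat \<Rightarrow> ('i, 'o, 'v) evmodel \<Rightarrow> ('i, 'v) input_trace \<Rightarrow> bool" where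
  "agrees_with n \<omega> \<rho> \<longleftrightarrow> (\<forall>t. enat t < n \<longrightarrow> ts \<omega> t = fst (\<rho> t) \<and> inputs_at \<omega> t = snd (\<rho> t))"

text \<open>
  An input trace consists of the timestamps and the input values. It may be finite or infinite:
  \<open>n\<close> is its length, and \<open>\<rho>\<close> is relevant only below \<open>n\<close>. The model is unique along the trace; for
  \<open>n = \<infinity>\<close> this is plain unique existence. The finite traces say that the outputs computed so far
  do not depend on inputs yet to come. Uniqueness for infinite traces alone does not give this: an
  output with equation \<open>x = x\<close> can be determined by a contradiction arising at a later step.
\<close>

definition well_defined :: "('i, 'o, 'v) spec \<Rightarrow> bool" where
  "well_defined \<phi> \<longleftrightarrow>
     (\<forall>\<rho> n. strict_mono (\<lambda>t. fst (\<rho> t)) \<longrightarrow>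
       (\<exists>\<omega>\<in>models \<phi>. agrees_with n \<omega> \<rho> \<and>
         (\<forall>\<omega>'\<in>models \<phi>. agrees_with n \<omega>' \<rho> \<longrightarrow> (\<forall>t. enat t < n \<longrightarrow> \<omega>' t = \<omega> t))))"

type_synonym 'i task = "'i set"

definition sat :: "('i, 'o, 'v) evmodel \<Rightarrow> nat \<Rightarrow> 'i task \<Rightarrow> bool" where
  "sat \<omega> t \<tau> \<longleftrightarrow> (\<forall>i\<in>\<tau>. inputs_at \<omega> t i \<noteq> None)"

definition reflects :: "('i \<Rightarrow> 'v option) \<Rightarrow> 'i task set \<Rightarrow> bool" where
  "reflects iv T \<longleftrightarrow> (\<forall>s. iv s \<noteq> None \<longleftrightarrow> {s} \<in> T)"

definition bandwidth :: "nat \<Rightarrow> ('i, 'o, 'v) evmodel \<Rightarrow> nat \<Rightarrow> bool" where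
  "bandwidth b \<omega> t \<longleftrightarrow> card {i. inputs_at \<omega> t i \<noteq> None} \<le> b"

text \<open>
  A condition is evaluated at \<open>(\<omega>, t)\<close> on the present and the past, i.e.\ on the events of the
  steps \<open>0, \<dots>, t\<close>.
\<close>

type_synonym ('i, 'o, 'v) cond = "('i, 'o, 'v) event list \<Rightarrow> bool"

definition holds :: "('i, 'o, 'v) cond \<Rightarrow> ('i, 'o, 'v) evmodel \<Rightarrow> nat \<Rightarrow> bool" where
  "holds c \<omega> t \<longleftrightarrow> c (map \<omega> [0..<Suc t])"

definition entails :: "('i, 'o, 'v) cond \<Rightarrow> ('i, 'o, 'v) cond \<Rightarrow> bool" where
  "entails c' c \<longleftrightarrow> (\<forall>\<omega> t. holds c' \<omega> t \<longrightarrow> holds c \<omega> t)"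

type_synonym ('i, 'o, 'v, 'p) annotation = "'i + 'o \<Rightarrow> (('i, 'o, 'v) cond \<times> 'p) set"
type_synonym ('i, 'o, 'v, 'p) static_schedule = "'i task \<Rightarrow> (('i, 'o, 'v) cond \<times> 'p) set"

definition candidates ::
  "('i, 'o, 'v) spec \<Rightarrow> ('i, 'o, 'v, 'p) annotation \<Rightarrow> 'i task \<Rightarrow> ('i, 'o, 'v) cond \<Rightarrow> 'p set" where
  "candidates \<phi> a \<tau> c = {v'. \<exists>s c'. pac \<phi> s \<subseteq> \<tau> \<and> (c', v') \<in> a s \<and> entails c' c}"

text \<open>
  \<open>le v' v\<close> says that \<open>v\<close> is at least as restrictive as \<open>v'\<close>. A pair is present only if the
  maximum exists.
\<close>

definition static_schedule ::
  "('p \<Rightarrow> 'p \<Rightarrow> bool) \<Rightarrow> ('i, 'o, 'v) cond set \<Rightarrow> ('i, 'o, 'v) spec \<Rightarrow>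
   ('i, 'o, 'v, 'p) annotation \<Rightarrow> ('i, 'o, 'v, 'p) static_schedule" where
  "static_schedule le Cond \<phi> a \<tau> =
     {(c, v). c \<in> Cond \<and> v \<in> candidates \<phi> a \<tau> c \<and> (\<forall>v'\<in>candidates \<phi> a \<tau> c. le v' v)}"

definition prio_schedule ::
  "('i, 'o, 'v) cond set \<Rightarrow> ('i, 'o, 'v) spec \<Rightarrow> ('i, 'o, 'v, nat) annotation \<Rightarrow>
   ('i, 'o, 'v, nat) static_schedule" where
  "prio_schedule = static_schedule (\<lambda>p' p. p' \<le> p)"

definition deadline_schedule ::
  "('i, 'o, 'v) cond set \<Rightarrow> ('i, 'o, 'v) spec \<Rightarrow> ('i, 'o, 'v, real) annotation \<Rightarrow>
   ('i, 'o, 'v, real) static_schedule" where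
  "deadline_schedule = static_schedule (\<lambda>d' d. d \<le> d')"

datatype verdict = Must | May | MustNot

type_synonym ('i, 'o, 'v) dyn_constraint = "('i, 'o, 'v) evmodel \<times> nat \<Rightarrow> 'i task \<Rightarrow> verdict"

definition constraint_sem :: "('i, 'o, 'v) dyn_constraint \<Rightarrow> ('i, 'o, 'v) evmodel set" where
  "constraint_sem \<psi> =
     {\<omega>. \<forall>t \<tau>. (\<psi> (\<omega>, t) \<tau> = Must \<longrightarrow> sat \<omega> (t + 1) \<tau>) \<and>
                (\<psi> (\<omega>, t) \<tau> = MustNot \<longrightarrow> \<not> sat \<omega> (t + 1) \<tau>)}"

definition last_before :: "(nat \<Rightarrow> bool) \<Rightarrow> nat \<Rightarrow> nat option" where
  "last_before P t = (if \<exists>u<t. P u then Some (GREATEST u. u < t \<and> P u) else None)"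

fun deadline_constraint :: "('i, 'o, 'v, real) static_schedule \<Rightarrow> ('i, 'o, 'v) dyn_constraint" where
  "deadline_constraint \<xi> (\<omega>, t) \<tau> =
     (if \<exists>(c, dl)\<in>\<xi> \<tau>. \<exists>t'<t. holds c \<omega> t' \<and> (\<forall>u. t' < u \<and> u \<le> t \<longrightarrow> \<not> sat \<omega> u \<tau>) \<and>
            ts \<omega> (t + 2) > ts \<omega> t' + dl
      then Must else May)"

text \<open>
  Several conditions of \<open>\<xi> \<tau>\<close> may have been true equally recently (a condition and a weaker one,
  say); the highest priority among them counts.
\<close>

fun most_recent ::
  "('i, 'o, 'v, nat) static_schedule \<Rightarrow> 'i task \<Rightarrow> ('i, 'o, 'v) evmodel \<Rightarrow> nat \<Rightarrow>
   ('i, 'o, 'v) cond \<times> nat \<Rightarrow> bool" where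
  "most_recent \<xi> \<tau> \<omega> t (c, p) \<longleftrightarrow>
     (c, p) \<in> \<xi> \<tau> \<and>
     (\<exists>u. last_before (holds c \<omega>) (t + 1) = Some u \<and>
       (\<forall>(c', p')\<in>\<xi> \<tau>. \<forall>u'. last_before (holds c' \<omega>) (t + 1) = Some u' \<longrightarrow>
          u' < u \<or> u' = u \<and> p' \<le> p))"

definition Prio ::
  "('i, 'o, 'v, nat) static_schedule \<Rightarrow> 'i task \<Rightarrow> ('i, 'o, 'v) evmodel \<Rightarrow> nat \<Rightarrow>
   (('i, 'o, 'v) cond \<times> nat) option" where
  "Prio \<xi> \<tau> \<omega> t =
     (if \<exists>cp. most_recent \<xi> \<tau> \<omega> t cp then Some (SOME cp. most_recent \<xi> \<tau> \<omega> t cp) else None)"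

text \<open>
  \<open>Q\<close> is an additional requirement on the task \<open>\<tau>'\<close> of lower priority.
\<close>

definition prio_condition ::
  "('i, 'o, 'v, nat) static_schedule \<Rightarrow> ('i task \<Rightarrow> bool) \<Rightarrow> ('i, 'o, 'v) evmodel \<Rightarrow> nat \<Rightarrow>
   'i task \<Rightarrow> bool" where
  "prio_condition \<xi> Q \<omega> t \<tau> \<longleftrightarrow>
     (\<exists>c1 p1 \<tau>' c2 p2. Prio \<xi> \<tau> \<omega> t = Some (c1, p1) \<and> Prio \<xi> \<tau>' \<omega> t = Some (c2, p2) \<and>
        sat \<omega> (t + 1) \<tau>' \<and> p1 > p2 \<and> Q \<tau>') \<and>
     \<not> (\<exists>\<tau>''. \<tau> \<subseteq> \<tau>'' \<and> sat \<omega> (t + 1) \<tau>'')"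

fun prio_constraint :: "('i, 'o, 'v, nat) static_schedule \<Rightarrow> ('i, 'o, 'v) dyn_constraint" where
  "prio_constraint \<xi> (\<omega>, t) \<tau> =
     (if prio_condition \<xi> (\<lambda>\<tau>'. True) \<omega> t \<tau> then Must else May)"

definition overdue ::
  "('i task \<Rightarrow> real) \<Rightarrow> 'i task \<Rightarrow> ('i, 'o, 'v) evmodel \<Rightarrow> nat \<Rightarrow> bool" where
  "overdue gdl \<tau> \<omega> t \<longleftrightarrow>
     (\<exists>\<tau>'\<subseteq>\<tau>. \<exists>u. last_before (\<lambda>u. sat \<omega> u \<tau>') t = Some u \<and> ts \<omega> t - ts \<omega> u > gdl \<tau>)"

fun deadline_prio_constraint ::
  "('i task \<Rightarrow> real) \<Rightarrow> ('i, 'o, 'v, nat) static_schedule \<Rightarrow> ('i, 'o, 'v) dyn_constraint" where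
  "deadline_prio_constraint gdl \<xi> (\<omega>, t) \<tau> =
     (if overdue gdl \<tau> \<omega> (t + 1) \<and> (\<exists>\<tau>'. \<not> overdue gdl \<tau>' \<omega> (t + 1) \<and> sat \<omega> (t + 1) \<tau>') \<or>
         prio_condition \<xi> (\<lambda>\<tau>'. \<not> overdue gdl \<tau>' \<omega> (t + 1)) \<omega> t \<tau>
      then Must else May)"

definition scheduled_models ::
  "('i, 'o, 'v) spec \<Rightarrow> ('i, 'o, 'v) dyn_constraint \<Rightarrow>
   (('i, 'o, 'v) evmodel \<Rightarrow> nat \<Rightarrow> bool) \<Rightarrow> ('i, 'o, 'v) evmodel set" where
  "scheduled_models \<phi> \<psi> B = {\<omega>. \<omega> \<in> models \<phi> \<and> \<omega> \<in> constraint_sem \<psi> \<and> (\<forall>t. B \<omega> t)}"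

type_synonym ('i, 'o, 'v) scheduler = "('i, 'o, 'v) evmodel \<times> nat \<Rightarrow> 'i task set"

definition valid_tasks :: "('i, 'o, 'v) evmodel \<Rightarrow> nat \<Rightarrow> 'i task set \<Rightarrow> bool" where
  "valid_tasks \<omega> t T \<longleftrightarrow>
     (\<forall>\<tau>. \<tau> \<in> T \<longleftrightarrow> sat \<omega> t \<tau>) \<and>
     (\<forall>\<tau>\<in>T. \<forall>\<tau>'. \<tau> \<subset> \<tau>' \<longrightarrow> \<tau>' \<in> T) \<and>
     (\<forall>\<tau>\<in>T. \<forall>\<tau>'\<in>T. \<tau> \<union> \<tau>' \<in> T)"

text \<open>\<open>W\<close> is the scheduled semantics \<open>scheduled_models \<phi> \<psi> B\<close>.\<close>

definition valid_scheduler ::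
  "('i, 'o, 'v) evmodel set \<Rightarrow> ('i, 'o, 'v) scheduler \<Rightarrow> bool" where
  "valid_scheduler W SA \<longleftrightarrow>
     (\<forall>\<omega>\<in>W. \<forall>t T iv.
        (\<forall>t'<t. valid_tasks \<omega> (t' + 1) (SA (\<omega>, t'))) \<and> SA (\<omega>, t) = T \<and> reflects iv T \<longrightarrow>
        (\<exists>\<omega>'\<in>W. valid_tasks \<omega>' (t + 1) T \<and> (\<forall>u\<le>t. \<omega>' u = \<omega> u) \<and> inputs_at \<omega>' (t + 1) = iv)) \<and>
     (\<forall>\<omega>\<in>W. \<forall>t. \<exists>t'>t. card (SA (\<omega>, t')) \<ge> 1)"

fun fill :: "nat \<Rightarrow> 'i task list \<Rightarrow> 'i set \<Rightarrow> 'i set" where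
  "fill b [] cur = cur"
| "fill b (\<tau> # \<tau>s) cur = (if card (cur \<union> \<tau>) \<le> b then fill b \<tau>s (cur \<union> \<tau>) else cur)"

definition greedy :: "nat \<Rightarrow> 'i task list \<Rightarrow> 'i task set" where
  "greedy b \<tau>s = {\<tau>. \<tau> \<subseteq> fill b \<tau>s {}}"

text \<open>
  The orders arise from stable sorts, the least significant key first; the list \<open>enum\<close> of all
  tasks settles the ties that remain. Tasks that were never evaluated count as the least recently
  evaluated ones.
\<close>

definition recency :: "('i, 'o, 'v) evmodel \<Rightarrow> nat \<Rightarrow> 'i task \<Rightarrow> nat" where
  "recency \<omega> t \<tau> = (case last_before (\<lambda>u. sat \<omega> u \<tau>) (t + 1) of None \<Rightarrow> 0 | Some u \<Rightarrow> u + 1)"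

text \<open>
  The next deadline of a task is \<open>\<infinity>\<close> if the task was never evaluated or if none of its conditions
  was true at its last evaluation.
\<close>

definition next_deadline ::
  "('i, 'o, 'v, real) static_schedule \<Rightarrow> ('i, 'o, 'v) evmodel \<Rightarrow> nat \<Rightarrow> 'i task \<Rightarrow> ereal" where
  "next_deadline \<xi> \<omega> t \<tau> =
     (case last_before (\<lambda>u. sat \<omega> u \<tau>) (t + 1) of
        None \<Rightarrow> \<infinity>
      | Some u \<Rightarrow> (INF dl\<in>{dl. \<exists>c. (c, dl) \<in> \<xi> \<tau> \<and> holds c \<omega> u}. ereal (ts \<omega> u + dl)))"

text \<open>Sorting is ascending; a task without a priority comes last.\<close>

definition prio_key ::
  "('i, 'o, 'v, nat) static_schedule \<Rightarrow> ('i, 'o, 'v) evmodel \<Rightarrow> nat \<Rightarrow> 'i task \<Rightarrow> int" where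
  "prio_key \<xi> \<omega> t \<tau> = (case Prio \<xi> \<tau> \<omega> t of None \<Rightarrow> 1 | Some (c, p) \<Rightarrow> - int p)"

fun DS ::
  "'i task list \<Rightarrow> ('i, 'o, 'v, real) static_schedule \<Rightarrow> nat \<Rightarrow> ('i, 'o, 'v) scheduler" where
  "DS enum \<xi> b (\<omega>, t) =
     greedy b (sort_key (next_deadline \<xi> \<omega> t) (sort_key (recency \<omega> t) enum))"

fun PS ::
  "'i task list \<Rightarrow> ('i, 'o, 'v, nat) static_schedule \<Rightarrow> nat \<Rightarrow> ('i, 'o, 'v) scheduler" where
  "PS enum \<xi> b (\<omega>, t) =
     greedy b (sort_key (prio_key \<xi> \<omega> t) (sort_key (recency \<omega> t) enum))"

fun DPS ::
  "'i task list \<Rightarrow> ('i task \<Rightarrow> real) \<Rightarrow> ('i, 'o, 'v, nat) static_schedule \<Rightarrow> nat \<Rightarrow>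
   ('i, 'o, 'v) scheduler" where
  "DPS enum gdl \<xi> b (\<omega>, t) =
     greedy b (sort_key (\<lambda>\<tau>. if overdue gdl \<tau> \<omega> (t + 1) then 0 else 1 :: nat)
       (sort_key (prio_key \<xi> \<omega> t) (sort_key (recency \<omega> t) enum)))"

definition task_permutations :: "'i task list set" where
  "task_permutations =
     {\<tau>s. length \<tau>s = card (UNIV :: 'i task set) \<and>
          (\<forall>i<length \<tau>s. \<forall>j<length \<tau>s. i = j \<or> \<tau>s ! i \<noteq> \<tau>s ! j)}"

text \<open>The recursion does not terminate on a task with more than \<open>b\<close> inputs: \<open>None\<close>.\<close>

partial_function (option) splits :: "nat \<Rightarrow> 'i task list \<Rightarrow> 'i set \<Rightarrow> nat option" where
  "splits b \<tau>s cur =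
     (case \<tau>s of
        [] \<Rightarrow> Some 1
      | \<tau> # \<tau>s' \<Rightarrow>
          if card (cur \<union> \<tau>) > b then Option.bind (splits b (\<tau> # \<tau>s') {}) (\<lambda>k. Some (1 + k))
          else splits b \<tau>s' (cur \<union> \<tau>))"

definition split_bound :: "'i itself \<Rightarrow> nat \<Rightarrow> nat" where
  "split_bound _ b =
     (LEAST n'. \<forall>\<tau>s\<in>(task_permutations :: 'i task list set). splits b \<tau>s {} = Some n')"

end

theory Submission
  imports Defs
begin

text \<open>
  The hypothesis on \<open>b\<close> lets the set of all inputs fit into one event, so each of the three schedulers
  returns all tasks in every cycle. A model that evaluates every input at all steps after the first
  meets every constraint that never answers \<open>MustNot\<close>, because a \<open>Must\<close> is then fulfilled
  anyway. Such a continuation of a given model prefix exists by well-definedness.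
\<close>

text \<open>No union of tasks exceeds \<open>b\<close>, so the branch of \<open>fill\<close> that
  stops early is never taken.\<close>

lemma fill_eq_Union:
  fixes \<tau>s :: "'i :: finite task list"
  assumes "card (UNIV :: 'i set) \<le> b"
  shows "fill b \<tau>s cur = cur \<union> \<Union> (set \<tau>s)"
proof (induction \<tau>s arbitrary: cur)
  case (Cons \<tau> \<tau>s)
  have "card (cur \<union> \<tau>) \<le> b"
    using card_mono[of UNIV "cur \<union> \<tau>"] assms by simp
  then show ?case
    using Cons by auto
qed simp

lemma greedy_eq_UNIV:
  fixes \<tau>s :: "'i :: finite task list"
  assumes "card (UNIV :: 'i set) \<le> b" and "UNIV \<in> set \<tau>s"
  shows "greedy b \<tau>s = UNIV"
  using assms by (auto simp: greedy_def fill_eq_Union)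

text \<open>Well-definedness enters twice: the infinite trace yields a continuation, and uniqueness
  along the finite trace of length \<open>Suc t\<close> forces its outputs up to \<open>t\<close> to
  be those of \<open>\<omega>\<close>.\<close>

lemma models_extend_prefix:
  assumes wd: "well_defined \<phi>" and \<omega>: "\<omega> \<in> models \<phi>"
  obtains \<omega>' where "\<omega>' \<in> models \<phi>" and "\<And>u. u \<le> t \<Longrightarrow> \<omega>' u = \<omega> u"
    and "\<And>u. t < u \<Longrightarrow> inputs_at \<omega>' u = iv"
proof -
  \<comment> \<open>The trace replays \<open>\<omega>\<close> up to \<open>t\<close> and then
    repeats \<open>iv\<close>, with timestamps advancing by 1 so that they stay strictly increasing
    across the boundary.\<close>
  define \<rho> where "\<rho> u = (if u \<le> t then (ts \<omega> u, inputs_at \<omega> u) else (ts \<omega> t + real (u - t), iv))"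
    for u
  have "strict_mono (ts \<omega>)"
    using \<omega> by (simp add: models_def)
  then have "ts \<omega> u < ts \<omega> (Suc u)" for u
    by (simp add: strict_mono_Suc_iff)
  then have mono: "strict_mono (\<lambda>u. fst (\<rho> u))"
    unfolding strict_mono_Suc_iff \<rho>_def
    by (auto simp: not_less_eq_eq le_Suc_eq Suc_diff_le)
  obtain \<omega>' where \<omega>': "\<omega>' \<in> models \<phi>" "agrees_with \<infinity> \<omega>' \<rho>"
    using wd mono unfolding well_defined_def by blast
  \<comment> \<open>\<open>\<omega>0\<close> is only a reference model: both \<open>\<omega>\<close>
    and \<open>\<omega>'\<close> coincide with it on the steps \<open>0\<close> to
    \<open>t\<close>.\<close>
  obtain \<omega>0 where \<omega>0: "\<And>\<omega>1 u. \<omega>1 \<in> models \<phi> \<Longrightarrow> agrees_with (enat (Suc t)) \<omega>1 \<rho> \<Longrightarrow>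
      enat u < enat (Suc t) \<Longrightarrow> \<omega>1 u = \<omega>0 u"
    using wd mono unfolding well_defined_def by metis
  have "agrees_with (enat (Suc t)) \<omega>' \<rho>"
    using \<omega>'(2) by (simp add: agrees_with_def)
  moreover have "agrees_with (enat (Suc t)) \<omega> \<rho>"
    by (simp add: agrees_with_def \<rho>_def)
  ultimately have "\<omega>' u = \<omega> u" if "u \<le> t" for u
    using \<omega>0[OF \<omega>'(1)] \<omega>0[OF \<omega>] that by simp
  moreover have "inputs_at \<omega>' u = iv" if "t < u" for u
    using \<omega>'(2) that by (simp add: agrees_with_def \<rho>_def)
  ultimately show thesis
    using that \<omega>'(1) by blast
qed

text \<open>Isolates what the three schedulers share, so that orders, priorities and deadlines drop
  out of the argument.\<close>

lemma valid_scheduler_all_tasks: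
  fixes \<phi> :: "('i :: finite, 'o, 'v) spec"
  assumes wd: "well_defined \<phi>" and b: "card (UNIV :: 'i set) \<le> b"
    and \<psi>: "\<And>\<omega> t \<tau>. \<psi> (\<omega>, t) \<tau> \<noteq> MustNot"
    and SA: "\<And>\<omega> t. SA (\<omega>, t) = UNIV"
  shows "valid_scheduler (scheduled_models \<phi> \<psi> (bandwidth b)) SA"
  unfolding valid_scheduler_def
proof (intro conjI ballI allI impI; (elim conjE)?)
  fix \<omega> :: "('i, 'o, 'v) evmodel" and t T and iv :: "'i \<Rightarrow> 'v option"
  assume \<omega>: "\<omega> \<in> scheduled_models \<phi> \<psi> (bandwidth b)"
    and past: "\<forall>t'<t. valid_tasks \<omega> (t' + 1) (SA (\<omega>, t'))"
    and T: "SA (\<omega>, t) = T" and iv: "reflects iv T"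
  obtain \<omega>' where \<omega>': "\<omega>' \<in> models \<phi>" "\<And>u. u \<le> t \<Longrightarrow> \<omega>' u = \<omega> u"
      "\<And>u. t < u \<Longrightarrow> inputs_at \<omega>' u = iv"
    using models_extend_prefix[OF wd] \<omega> unfolding scheduled_models_def by blast
  have T_UNIV: "T = UNIV"
    using T SA by simp
  \<comment> \<open>Up to step \<open>t\<close> the validity of the past choices gives satisfaction;
    afterwards \<open>iv\<close> has a value for every input, since it reflects the set of all
    tasks. Positive steps suffice, because constraints speak about \<open>t + 1\<close>.\<close>
  have sat_all: "sat \<omega>' (Suc u) \<tau>" for u \<tau>
  proof (cases "u < t")
    case True
    then have "sat \<omega> (Suc u) \<tau>"
      using past SA by (simp add: valid_tasks_def)
    then show ?thesis
      using \<omega>'(2)[of "Suc u"] True by (simp add: sat_def inputs_at_def val_def)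
  next
    case False
    then show ?thesis
      using \<omega>'(3)[of "Suc u"] iv T_UNIV by (simp add: sat_def reflects_def)
  qed
  have "bandwidth b \<omega>' u" for u
    using card_mono[OF finite subset_UNIV] b le_trans unfolding bandwidth_def by blast
  then have "\<omega>' \<in> scheduled_models \<phi> \<psi> (bandwidth b)"
    using \<omega>'(1) sat_all \<psi> by (auto simp: scheduled_models_def constraint_sem_def)
  moreover have "valid_tasks \<omega>' (t + 1) T"
    using sat_all T_UNIV by (simp add: valid_tasks_def)
  ultimately show "\<exists>\<omega>'\<in>scheduled_models \<phi> \<psi> (bandwidth b). valid_tasks \<omega>' (t + 1) T \<and>
      (\<forall>u\<le>t. \<omega>' u = \<omega> u) \<and> inputs_at \<omega>' (t + 1) = iv"
    using \<omega>' by (intro bexI[of _ \<omega>']) auto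
next
  fix \<omega> :: "('i, 'o, 'v) evmodel" and t
  show "\<exists>t'>t. 1 \<le> card (SA (\<omega>, t'))"
    \<comment> \<open>Finiteness of \<open>'i\<close> makes the set of all tasks finite, so its
      \<open>card\<close> is positive rather than the default 0.\<close>
    by (intro exI[of _ "Suc t"]) (simp add: SA Suc_le_eq card_gt_0_iff)
qed

theorem theorem1:
  fixes \<phi> :: "('i :: finite, 'o, 'v) spec"
    and Cond :: "('i, 'o, 'v) cond set"
    and a_prio :: "('i, 'o, 'v, nat) annotation"
    and a_dl :: "('i, 'o, 'v, real) annotation"
    and gdl :: "'i task \<Rightarrow> real"
    and enum :: "'i task list"
    and b :: nat
  assumes "well_defined \<phi>"
    and "\<And>s. a_prio s \<subseteq> Cond \<times> UNIV"
    and "\<And>s. a_dl s \<subseteq> Cond \<times> UNIV"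
    and "distinct enum" and "set enum = UNIV"
  defines "\<xi>p \<equiv> prio_schedule Cond \<phi> a_prio"
    and "\<xi>d \<equiv> deadline_schedule Cond \<phi> a_dl"
  shows "(b \<ge> Max (card ` (UNIV :: 'i task set)) \<longrightarrow>
            valid_scheduler (scheduled_models \<phi> (prio_constraint \<xi>p) (bandwidth b)) (PS enum \<xi>p b) \<and>
            valid_scheduler (scheduled_models \<phi> (deadline_prio_constraint gdl \<xi>p) (bandwidth b))
              (DPS enum gdl \<xi>p b)) \<and>
         ((\<forall>\<tau>. \<forall>(c, dl)\<in>\<xi>d \<tau>. dl > real (split_bound TYPE('i) b)) \<and>
          b \<ge> Max (card ` (UNIV :: 'i task set)) \<longrightarrow>
            valid_scheduler (scheduled_models \<phi> (deadline_constraint \<xi>d) (bandwidth b)) (DS enum \<xi>d b))"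
proof -
  \<comment> \<open>The existential over \<open>\<tau>s\<close> hides the sort order: sorting keeps
    the set of listed tasks.\<close>
  have valid: "valid_scheduler (scheduled_models \<phi> \<psi> (bandwidth b)) SA"
    if b: "b \<ge> Max (card ` (UNIV :: 'i task set))"
      and \<psi>: "\<And>\<omega> t \<tau>. \<psi> (\<omega>, t) \<tau> \<noteq> MustNot"
      and SA: "\<And>\<omega> t. \<exists>\<tau>s. SA (\<omega>, t) = greedy b \<tau>s \<and> set \<tau>s = UNIV"
    for \<psi> :: "('i, 'o, 'v) dyn_constraint" and SA
  proof (rule valid_scheduler_all_tasks[where \<psi> = \<psi>, OF \<open>well_defined \<phi>\<close> _ \<psi>])
    \<comment> \<open>The maximum covers the task \<open>UNIV\<close>.\<close>
    show card_le: "card (UNIV :: 'i set) \<le> b"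
      using b by simp
    show "SA (\<omega>, t) = UNIV" for \<omega> t
      using SA[of \<omega> t] greedy_eq_UNIV[OF card_le] by auto
  qed
  \<comment> \<open>Each constraint is a conditional between \<open>Must\<close> and
    \<open>May\<close>, which rules out \<open>MustNot\<close>.\<close>
  show ?thesis
    using \<open>set enum = UNIV\<close> by (intro conjI impI; (elim conjE)?; intro valid) (auto split: if_splits)
qed

end
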